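(* The Shannon entropy (in bits) of the probability distribution $\mathcal{L}$ on isomorphism classes of graphs of order $n$ equals \[ \frac{n^2}{4\ln 2}+O(n\log n), \] whereas the Shannon entropy of the uniform distribution on isomorphism classes of graphs of order $n$ equals $\frac{n^2}{2}+O(n\log n)$ bits. Moreover, if $G_n$ is the output after reaching $n$ vertices of the uniform sequential attachment process, then \[ -\frac{1}{n^2}\log_2\mathcal{L}(G_n)\longrightarrow\frac{1}{4\ln 2}\quad\text{in probability as } n\to\infty. \]
   Context: Graphs are finite, simple and undirected. Uniform sequential attachment process: $G_1=K_1$, and for $t\ge 2$ the random graph $G_t$ is obtained from $G_{t-1}$ (which has $t-1$ vertices) as follows: choose $k$ uniformly from $\{0,1,\dots,t-1\}$, then choose a $k$-element subset $W$ of $V(G_{t-1})$ uniformly at random, then add a new vertex adjacent to exactly the vertices of $W$; all choices are independent across steps. For a graph $G$ on $n$ vertices, its likelihood is $\mathcal{L}(G)=\Pr[G_n\cong G]$; thus $\mathcal{L}$ is a probability distribution on the isomorphism classes of graphs of order $n$. The Shannon entropy in bits of a distribution $(p_x)$ is $-\sum_x p_x\log_2 p_x$. Numerically $\frac{1}{4\ln 2}=0.36067\ldots$. *)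

theory Defs
  imports "HOL-Probability.Probability" "HOL-Library.Landau_Symbols" "HOL-Library.Monad_Syntax"
begin

type_synonym 'a graph = "'a set \<times> 'a set set"

abbreviation verts :: "'a graph \<Rightarrow> 'a set" where "verts \<equiv> fst"
abbreviation edges :: "'a graph \<Rightarrow> 'a set set" where "edges \<equiv> snd"

definition simple_graph :: "'a graph \<Rightarrow> bool" where
  "simple_graph G \<longleftrightarrow> finite (verts G) \<and> edges G \<subseteq> {e. e \<subseteq> verts G \<and> card e = 2}"

definition graph_iso :: "'a graph \<Rightarrow> 'b graph \<Rightarrow> bool"  (infix "\<cong>\<^sub>G" 50) where
  "G \<cong>\<^sub>G H \<longleftrightarrow> (\<exists>f. bij_betw f (verts G) (verts H) \<and>
     (\<forall>u\<in>verts G. \<forall>v\<in>verts G. {u, v} \<in> edges G \<longleftrightarrow> {f u, f v} \<in> edges H))"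

text \<open>
  Every graph of order \<open>n\<close> is isomorphic to one with vertex set \<open>{0, \<dots>, n - 1}\<close>, so the
  isomorphism classes of graphs of order \<open>n\<close> are the classes of these labelled graphs.
\<close>

definition labelled_graphs :: "nat \<Rightarrow> nat graph set" where
  "labelled_graphs n = {G. simple_graph G \<and> verts G = {..<n}}"

definition iso_rel :: "nat \<Rightarrow> nat graph rel" where
  "iso_rel n = {(G, H). G \<in> labelled_graphs n \<and> H \<in> labelled_graphs n \<and> G \<cong>\<^sub>G H}"

definition iso_classes :: "nat \<Rightarrow> nat graph set set" where
  "iso_classes n = labelled_graphs n // iso_rel n"

definition attach :: "'a \<Rightarrow> 'a set \<Rightarrow> 'a graph \<Rightarrow> 'a graph" where
  "attach v W G = (insert v (verts G), edges G \<union> {{v, w} |w. w \<in> W})"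

definition attach_step :: "'a \<Rightarrow> 'a graph \<Rightarrow> 'a graph pmf" where
  "attach_step v G = do {
     k \<leftarrow> pmf_of_set {0..card (verts G)};
     W \<leftarrow> pmf_of_set {W. W \<subseteq> verts G \<and> card W = k};
     return_pmf (attach v W G)
   }"

text \<open>
  \<open>seq_attach n\<close> is the law of \<open>G\<^sub>n\<close>, on the vertices \<open>0, \<dots>, n - 1\<close> in order of arrival.
  The process starts at \<open>G\<^sub>1 = K\<^sub>1\<close>; the empty graph at index \<open>0\<close> is a convention.
\<close>

fun seq_attach :: "nat \<Rightarrow> nat graph pmf" where
  "seq_attach 0 = return_pmf ({}, {})"
| "seq_attach (Suc 0) = return_pmf ({0}, {})"
| "seq_attach (Suc (Suc m)) = seq_attach (Suc m) \<bind> attach_step (Suc m)"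

definition likelihood :: "'a graph \<Rightarrow> real" where
  "likelihood G = measure_pmf.prob (seq_attach (card (verts G))) {H. H \<cong>\<^sub>G G}"

text \<open>
  The likelihood as a distribution on isomorphism classes: the law of the class of \<open>G\<^sub>n\<close>.
  Lemma \<open>pmf_likelihood_pmf\<close> below shows that the class of \<open>G\<close> gets mass \<open>likelihood G\<close>.
\<close>

definition likelihood_pmf :: "nat \<Rightarrow> nat graph set pmf" where
  "likelihood_pmf n = map_pmf (\<lambda>G. iso_rel n `` {G}) (seq_attach n)"

definition entropy_bits :: "'a pmf \<Rightarrow> real" where
  "entropy_bits p = - (\<Sum>\<^sub>\<infinity>x\<in>set_pmf p. pmf p x * log 2 (pmf p x))"

text \<open>
  Convergence in probability to a constant depends only on the laws \<open>p n\<close> of the individual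
  random objects, so no common probability space is needed.
\<close>

definition tendsto_const_in_prob ::
    "(nat \<Rightarrow> 'a pmf) \<Rightarrow> (nat \<Rightarrow> 'a \<Rightarrow> real) \<Rightarrow> real \<Rightarrow> bool" where
  "tendsto_const_in_prob p X c \<longleftrightarrow>
     (\<forall>\<epsilon>>0. (\<lambda>n. measure_pmf.prob (p n) {\<omega>. \<bar>X n \<omega> - c\<bar> > \<epsilon>}) \<longlonglongrightarrow> 0)"

lemma graph_iso_refl: "G \<cong>\<^sub>G G"
  unfolding graph_iso_def by (rule exI[of _ id]) auto

lemma graph_iso_sym:
  assumes "G \<cong>\<^sub>G H"
  shows "H \<cong>\<^sub>G G"
proof -
  from assms obtain f where f: "bij_betw f (verts G) (verts H)"
    and e: "\<And>u v. u \<in> verts G \<Longrightarrow> v \<in> verts G \<Longrightarrow> {u, v} \<in> edges G \<longleftrightarrow> {f u, f v} \<in> edges H"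
    unfolding graph_iso_def by blast
  let ?g = "the_inv_into (verts G) f"
  have g: "bij_betw ?g (verts H) (verts G)"
    by (rule bij_betw_the_inv_into[OF f])
  have "{u, v} \<in> edges H \<longleftrightarrow> {?g u, ?g v} \<in> edges G" if "u \<in> verts H" "v \<in> verts H" for u v
    using e[of "?g u" "?g v"] bij_betwE[OF g] that f_the_inv_into_f_bij_betw[OF f] by auto
  with g show ?thesis unfolding graph_iso_def by blast
qed

lemma graph_iso_trans:
  assumes "G \<cong>\<^sub>G H" "H \<cong>\<^sub>G K"
  shows "G \<cong>\<^sub>G K"
proof -
  from assms(1) obtain f where f: "bij_betw f (verts G) (verts H)"
    and ef: "\<forall>u\<in>verts G. \<forall>v\<in>verts G. {u, v} \<in> edges G \<longleftrightarrow> {f u, f v} \<in> edges H"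
    unfolding graph_iso_def by blast
  from assms(2) obtain g where g: "bij_betw g (verts H) (verts K)"
    and eg: "\<forall>u\<in>verts H. \<forall>v\<in>verts H. {u, v} \<in> edges H \<longleftrightarrow> {g u, g v} \<in> edges K"
    unfolding graph_iso_def by blast
  have "bij_betw (g \<circ> f) (verts G) (verts K)"
    by (rule bij_betw_trans[OF f g])
  moreover have "\<forall>u\<in>verts G. \<forall>v\<in>verts G.
      {u, v} \<in> edges G \<longleftrightarrow> {(g \<circ> f) u, (g \<circ> f) v} \<in> edges K"
    using ef eg bij_betwE[OF f] by auto
  ultimately show ?thesis unfolding graph_iso_def by blast
qed

lemma equiv_iso_rel: "equiv (labelled_graphs n) (iso_rel n)"
  by (intro equivI refl_onI symI transI)
     (auto simp: iso_rel_def intro: graph_iso_refl graph_iso_sym graph_iso_trans)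

lemma finite_labelled_graphs: "finite (labelled_graphs n)"
proof (rule finite_subset)
  show "labelled_graphs n \<subseteq> {{..<n}} \<times> Pow (Pow {..<n})"
    unfolding labelled_graphs_def simple_graph_def by (force simp: mem_Times_iff)
qed auto

lemma finite_iso_classes: "finite (iso_classes n)"
  unfolding iso_classes_def
  by (rule finite_quotient[OF finite_labelled_graphs]) (auto simp: iso_rel_def)

lemma iso_classes_nonempty: "iso_classes n \<noteq> {}"
proof -
  have "({..<n}, {}) \<in> labelled_graphs n"
    by (simp add: labelled_graphs_def simple_graph_def)
  then show ?thesis
    unfolding iso_classes_def by (auto simp: quotient_def)
qed

lemma set_pmf_attach_step:
  assumes "finite (verts G)"
  shows "set_pmf (attach_step v G) = (\<lambda>W. attach v W G) ` Pow (verts G)"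
proof -
  have fin: "finite {W. W \<subseteq> verts G \<and> card W = k}" for k
    using assms by (auto intro: finite_subset[of _ "Pow (verts G)"])
  have ne: "{W. W \<subseteq> verts G \<and> card W = k} \<noteq> {}" if "k \<le> card (verts G)" for k
    using obtain_subset_with_card_n[OF that] by blast
  have set_choice: "set_pmf (pmf_of_set {W. W \<subseteq> verts G \<and> card W = k}) =
      {W. W \<subseteq> verts G \<and> card W = k}" if "k \<in> {0..card (verts G)}" for k
    using that by (intro set_pmf_of_set fin ne) auto
  have "set_pmf (attach_step v G) =
      (\<Union>k\<in>{0..card (verts G)}. (\<lambda>W. attach v W G) ` {W. W \<subseteq> verts G \<and> card W = k})"
    using set_choice by (simp add: attach_step_def UNION_singleton_eq_range)
  also have "\<dots> = (\<lambda>W. attach v W G) ` Pow (verts G)"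
  proof -
    have "(\<Union>k\<in>{0..card (verts G)}. {W. W \<subseteq> verts G \<and> card W = k}) = Pow (verts G)"
      using card_mono[OF assms] by auto
    then show ?thesis by (simp add: image_UN[symmetric])
  qed
  finally show ?thesis .
qed

lemma set_pmf_seq_attach: "set_pmf (seq_attach n) \<subseteq> labelled_graphs n"
proof (induction n rule: seq_attach.induct)
  case (3 m)
  have *: "attach (Suc m) W G \<in> labelled_graphs (Suc (Suc m))"
    if G: "G \<in> labelled_graphs (Suc m)" and W: "W \<subseteq> verts G" for W G
  proof -
    have E: "e \<subseteq> {..<Suc m} \<and> card e = 2" if "e \<in> edges G" for e
      using G that unfolding labelled_graphs_def simple_graph_def by auto
    have V: "verts G = {..<Suc m}"
      using G unfolding labelled_graphs_def by simp
    have "{Suc m, w} \<subseteq> {..<Suc (Suc m)} \<and> card {Suc m, w} = 2" if "w \<in> W" for w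
      using W that unfolding V by auto
    moreover have "e \<subseteq> {..<Suc (Suc m)} \<and> card e = 2" if "e \<in> edges G" for e
      using E[OF that] by auto
    moreover have "insert (Suc m) {..<Suc m} = {..<Suc (Suc m)}"
      by auto
    ultimately show ?thesis
      unfolding labelled_graphs_def simple_graph_def attach_def V by auto
  qed
  have fin: "finite (verts G)" if "G \<in> labelled_graphs k" for G k
    using that by (simp add: labelled_graphs_def)
  show ?case
  proof
    fix H assume "H \<in> set_pmf (seq_attach (Suc (Suc m)))"
    then obtain G where "G \<in> set_pmf (seq_attach (Suc m))"
      and H: "H \<in> set_pmf (attach_step (Suc m) G)"
      by auto
    with "3" have G: "G \<in> labelled_graphs (Suc m)"
      by blast
    show "H \<in> labelled_graphs (Suc (Suc m))"
      using H *[OF G] unfolding set_pmf_attach_step[OF fin[OF G]] by blast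
  qed
qed (auto simp: labelled_graphs_def simple_graph_def)

lemma pmf_likelihood_pmf:
  assumes "G \<in> labelled_graphs n"
  shows "pmf (likelihood_pmf n) (iso_rel n `` {G}) = likelihood G"
proof -
  have *: "iso_rel n `` {H} = iso_rel n `` {G} \<longleftrightarrow> H \<cong>\<^sub>G G" if "H \<in> set_pmf (seq_attach n)" for H
    using eq_equiv_class_iff[OF equiv_iso_rel, of H n G] set_pmf_seq_attach[of n] that assms
    by (auto simp: iso_rel_def)
  have "pmf (likelihood_pmf n) (iso_rel n `` {G}) =
      measure_pmf.prob (seq_attach n) {H. iso_rel n `` {H} = iso_rel n `` {G}}"
    by (simp add: likelihood_pmf_def pmf_map vimage_def)
  also have "\<dots> = measure_pmf.prob (seq_attach n) {H. H \<cong>\<^sub>G G}"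
    by (rule measure_pmf.finite_measure_eq_AE) (auto simp: AE_measure_pmf_iff *)
  also have "\<dots> = likelihood G"
    using assms by (simp add: likelihood_def labelled_graphs_def)
  finally show ?thesis .
qed

lemma set_pmf_likelihood_pmf: "set_pmf (likelihood_pmf n) \<subseteq> iso_classes n"
  using set_pmf_seq_attach[of n]
  by (auto simp: likelihood_pmf_def iso_classes_def intro: quotientI)

end

theory Submission
  imports Defs "HOL-Real_Asymp.Real_Asymp" "HOL-Combinatorics.Permutations"
begin

text \<open>
  Write \<open>Q\<close> for the law of the labelled graph \<open>G\<^sub>n\<close>, with vertices named by order of arrival.
  The labelled graph records every choice of the process, so its surprisal \<open>- log\<^sub>2 Q(G\<^sub>n)\<close> is a
  sum of independent terms: vertex \<open>m\<close> joins \<open>k\<close> of the \<open>m\<close> earlier vertices, \<open>k\<close> uniform, and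
  contributes \<open>log\<^sub>2 ((m + 1) * (m choose k))\<close>. The average of \<open>ln (m choose k)\<close> over \<open>k \<le> m\<close> is
  \<open>m / 2 + O(log m)\<close>, so the mean of the sum, which is the entropy of \<open>Q\<close>, is
  \<open>n\<^sup>2 / (4 ln 2) + O(n log n)\<close> (\<open>labelled_entropy_bound\<close>). The factor \<open>1/4\<close>, as opposed to \<open>1/2\<close>
  for a uniform labelled graph, comes from choosing the degree before the neighbourhood.

  Passing from labelled graphs to isomorphism classes is a map whose fibres have at most \<open>n!\<close>
  elements. Such a map never raises the surprisal of a point, and the expected loss is at most
  \<open>log\<^sub>2 n! \<le> n log\<^sub>2 n\<close> (\<open>expectation_surprisal_loss_le\<close>), which is within the error term. The same
  bound on the fibres gives \<open>2 ^ (n choose 2) / n! \<le> |iso_classes n| \<le> 2 ^ (n choose 2)\<close>, and the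
  entropy of a uniform distribution is the logarithm of the number of points.

  For the convergence in probability, every term of the sum is at most \<open>2 n\<close>, so by independence the
  variance of the labelled surprisal is \<open>O(n\<^sup>3)\<close> and its expected absolute deviation is
  \<open>O(n powr (3/2))\<close>. Together with the loss bound, \<open>- log\<^sub>2 (likelihood G\<^sub>n)\<close> is within \<open>o(n\<^sup>2)\<close> of
  \<open>n\<^sup>2 / (4 ln 2)\<close> in expectation, and Markov's inequality finishes the proof.
\<close>

section \<open>Surprisal of finitely supported distributions\<close>

definition surprisal :: "'a pmf \<Rightarrow> 'a \<Rightarrow> real" where
  "surprisal p x = - log 2 (pmf p x)"

lemma expectation_finite_support:
  fixes f :: "'a \<Rightarrow> real"
  assumes "finite (set_pmf p)"
  shows "measure_pmf.expectation p f = (\<Sum>x\<in>set_pmf p. f x * pmf p x)"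
  using assms by (intro integral_measure_pmf_real) auto

lemma entropy_bits_eq_expectation:
  assumes "finite (set_pmf p)"
  shows "entropy_bits p = measure_pmf.expectation p (surprisal p)"
  using assms
  by (simp add: entropy_bits_def surprisal_def expectation_finite_support sum_negf mult.commute)

lemma expectation_mono_support:
  fixes f g :: "'a \<Rightarrow> real"
  assumes "finite (set_pmf p)" "\<And>x. x \<in> set_pmf p \<Longrightarrow> f x \<le> g x"
  shows "measure_pmf.expectation p f \<le> measure_pmf.expectation p g"
  using assms by (intro integral_mono_AE integrable_measure_pmf_finite) (auto simp: AE_measure_pmf_iff)

lemma expectation_cong_support:
  fixes f g :: "'a \<Rightarrow> real"
  assumes "\<And>x. x \<in> set_pmf p \<Longrightarrow> f x = g x"
  shows "measure_pmf.expectation p f = measure_pmf.expectation p g"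
  using assms by (intro integral_cong_AE) (auto simp: AE_measure_pmf_iff)

text \<open>
  A point of the image carries the mass of its whole fibre, so merging points can only lower the
  surprisal. The next lemma bounds the expected drop.
\<close>

lemma surprisal_map_le:
  assumes "x \<in> set_pmf p"
  shows "surprisal (map_pmf f p) (f x) \<le> surprisal p x"
proof -
  have "pmf p x = measure_pmf.prob p {x}"
    by (simp add: measure_pmf_single)
  also have "\<dots> \<le> pmf (map_pmf f p) (f x)"
    unfolding pmf_map by (intro measure_pmf.finite_measure_mono) auto
  finally show ?thesis
    using pmf_positive[OF assms] by (simp add: surprisal_def)
qed

text \<open>
  With \<open>q\<close> the image distribution, the expectation of the ratio \<open>q (f x) / p x\<close> is the sum of
  \<open>q (f x)\<close> over the support, where every image point is counted once for each element of its fibre;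
  hence it is at most \<open>K\<close>. Concavity of the logarithm turns this into the claim. The tangent line
  \<open>ln t \<le> t / K - 1 + ln K\<close> takes the place of Jensen's inequality, because it is linear in the ratio.
\<close>

lemma expectation_surprisal_loss_le:
  assumes fin: "finite (set_pmf p)" and K: "K \<ge> 1"
    and fibre: "\<And>x. x \<in> set_pmf p \<Longrightarrow> card {y \<in> set_pmf p. f y = f x} \<le> K"
  shows "measure_pmf.expectation p (\<lambda>x. surprisal p x - surprisal (map_pmf f p) (f x)) \<le> log 2 (real K)"
proof -
  let ?q = "map_pmf f p"
  let ?S = "set_pmf p"
  have ratio: "(\<Sum>x\<in>?S. pmf ?q (f x)) \<le> real K"
  proof -
    have "(\<Sum>x\<in>?S. pmf ?q (f x)) = (\<Sum>z\<in>f ` ?S. \<Sum>x\<in>{x \<in> ?S. f x = z}. pmf ?q (f x))"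
      by (rule sum.image_gen[OF fin])
    also have "\<dots> = (\<Sum>z\<in>f ` ?S. real (card {x \<in> ?S. f x = z}) * pmf ?q z)"
      by (intro sum.cong) auto
    also have "\<dots> \<le> (\<Sum>z\<in>f ` ?S. real K * pmf ?q z)"
      using fibre by (intro sum_mono mult_right_mono) auto
    also have "\<dots> = real K"
      using sum_pmf_eq_1[of "f ` ?S" ?q] fin by (simp add: sum_distrib_left[symmetric])
    finally show ?thesis .
  qed
  have pointwise: "(surprisal p x - surprisal ?q (f x)) * ln 2 * pmf p x \<le>
      pmf ?q (f x) / K - pmf p x + ln (real K) * pmf p x" if x: "x \<in> ?S" for x
  proof -
    define u v where "u = pmf p x" and "v = pmf ?q (f x)"
    have u: "u > 0" and v: "v > 0"
      using x pmf_positive[of x p] pmf_positive[of "f x" ?q] by (auto simp: u_def v_def)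
    have "ln (v / u / K) \<le> v / u / K - 1"
      using u v K by (intro ln_le_minus_one) auto
    then have "ln v - ln u - ln (real K) \<le> v / u / K - 1"
      using u v K by (simp add: ln_div ln_mult)
    then have "(ln v - ln u) * u \<le> (v / u / K - 1 + ln (real K)) * u"
      using u by (intro mult_right_mono) auto
    also have "\<dots> = v / K - u + ln (real K) * u"
      using u by (simp add: field_simps)
    finally have "(ln v - ln u) * u \<le> v / K - u + ln (real K) * u" .
    moreover have "(surprisal p x - surprisal ?q (f x)) * ln 2 = ln v - ln u"
      by (simp add: surprisal_def log_def u_def[symmetric] v_def[symmetric] left_diff_distrib)
    ultimately show ?thesis
      by (simp only: u_def[symmetric] v_def[symmetric])
  qed
  have "measure_pmf.expectation p (\<lambda>x. surprisal p x - surprisal ?q (f x)) * ln 2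
      = (\<Sum>x\<in>?S. (surprisal p x - surprisal ?q (f x)) * ln 2 * pmf p x)"
    by (simp add: expectation_finite_support[OF fin] sum_distrib_right sum_distrib_left mult_ac)
  also have "\<dots> \<le> (\<Sum>x\<in>?S. pmf ?q (f x) / K - pmf p x + ln (real K) * pmf p x)"
    by (intro sum_mono pointwise)
  also have "\<dots> = (\<Sum>x\<in>?S. pmf ?q (f x)) / K - 1 + ln (real K)"
    using sum_pmf_eq_1[of ?S p] fin
    by (simp add: sum.distrib sum_subtractf sum_divide_distrib[symmetric] sum_distrib_left[symmetric])
  also have "\<dots> \<le> ln (real K)"
    using ratio K by simp
  finally show ?thesis
    by (simp add: log_def field_simps)
qed

lemma expectation_pair_mult:
  fixes f :: "'a \<Rightarrow> real" and g :: "'b \<Rightarrow> real"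
  assumes "finite (set_pmf p)" "finite (set_pmf q)"
  shows "measure_pmf.expectation (pair_pmf p q) (\<lambda>z. f (fst z) * g (snd z))
       = measure_pmf.expectation p f * measure_pmf.expectation q g"
proof -
  have "measure_pmf.expectation (pair_pmf p q) (\<lambda>z. f (fst z) * g (snd z)) =
      (\<Sum>(x, y)\<in>set_pmf p \<times> set_pmf q. (f x * pmf p x) * (g y * pmf q y))"
    using assms by (subst expectation_finite_support) (auto intro!: sum.cong simp: pmf_pair)
  also have "\<dots> = (\<Sum>x\<in>set_pmf p. f x * pmf p x) * (\<Sum>y\<in>set_pmf q. g y * pmf q y)"
    by (simp only: sum_product sum.cartesian_product)
  finally show ?thesis
    using assms by (simp only: expectation_finite_support)
qed

lemma expectation_pair_add:
  fixes f :: "'a \<Rightarrow> real" and g :: "'b \<Rightarrow> real"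
  assumes "finite (set_pmf p)" "finite (set_pmf q)"
  shows "measure_pmf.expectation (pair_pmf p q) (\<lambda>z. f (fst z) + g (snd z))
       = measure_pmf.expectation p f + measure_pmf.expectation q g"
  using assms by (subst Bochner_Integration.integral_add) (auto intro!: integrable_measure_pmf_finite)

lemma variance_pair_add:
  fixes f :: "'a \<Rightarrow> real" and g :: "'b \<Rightarrow> real"
  assumes fin: "finite (set_pmf p)" "finite (set_pmf q)"
  shows "measure_pmf.variance (pair_pmf p q) (\<lambda>z. f (fst z) + g (snd z))
       = measure_pmf.variance p f + measure_pmf.variance q g"
proof -
  define u where "u x = f x - measure_pmf.expectation p f" for x
  define v where "v y = g y - measure_pmf.expectation q g" for y
  let ?E = "measure_pmf.expectation (pair_pmf p q)"
  have int: "integrable (pair_pmf p q) h" for h :: "'a \<times> 'b \<Rightarrow> real"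
    using fin by (intro integrable_measure_pmf_finite) auto
  have "measure_pmf.expectation p u = 0"
    unfolding u_def using fin by (subst Bochner_Integration.integral_diff) (auto intro!: integrable_measure_pmf_finite)
  then have cross: "?E (\<lambda>z. u (fst z) * v (snd z)) = 0"
    by (simp add: expectation_pair_mult fin)
  have "measure_pmf.variance (pair_pmf p q) (\<lambda>z. f (fst z) + g (snd z))
      = ?E (\<lambda>z. (u (fst z))\<^sup>2 + (v (snd z))\<^sup>2 + 2 * (u (fst z) * v (snd z)))"
    unfolding expectation_pair_add[OF fin] u_def v_def
    by (intro Bochner_Integration.integral_cong) (auto simp: power2_eq_square algebra_simps)
  also have "\<dots> = ?E (\<lambda>z. (u (fst z))\<^sup>2 + (v (snd z))\<^sup>2) + 2 * ?E (\<lambda>z. u (fst z) * v (snd z))"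
    by (subst Bochner_Integration.integral_add) (auto intro!: int)
  also have "\<dots> = measure_pmf.variance p f + measure_pmf.variance q g"
    using expectation_pair_add[OF fin, of "\<lambda>x. (u x)\<^sup>2" "\<lambda>y. (v y)\<^sup>2"] cross
    by (simp add: u_def v_def)
  finally show ?thesis .
qed

section \<open>The sequential attachment process as a product\<close>

text \<open>
  The law of the neighbourhood that vertex \<open>m\<close> picks among the earlier vertices. It does not depend
  on the graph built so far, which is why the surprisals of the steps are independent.
\<close>

definition nbhd_pmf :: "nat \<Rightarrow> nat set pmf" where
  "nbhd_pmf m = pmf_of_set {0..m} \<bind> (\<lambda>k. pmf_of_set {W. W \<subseteq> {..<m} \<and> card W = k})"

lemma finite_subsets_card: "finite {W. W \<subseteq> {..<m::nat} \<and> card W = k}"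
  by (rule finite_subset[of _ "Pow {..<m}"]) auto

lemma subsets_card_nonempty: "k \<le> m \<Longrightarrow> {W. W \<subseteq> {..<m::nat} \<and> card W = k} \<noteq> {}"
  using obtain_subset_with_card_n[of k "{..<m}"] by auto

lemma set_pmf_of_subsets_card:
  "k \<le> m \<Longrightarrow> set_pmf (pmf_of_set {W. W \<subseteq> {..<m::nat} \<and> card W = k}) = {W. W \<subseteq> {..<m} \<and> card W = k}"
  by (intro set_pmf_of_set finite_subsets_card subsets_card_nonempty)

lemma set_pmf_nbhd_pmf: "set_pmf (nbhd_pmf m) \<subseteq> Pow {..<m}"
  by (auto simp: nbhd_pmf_def set_pmf_of_subsets_card)

lemma finite_set_pmf_nbhd_pmf: "finite (set_pmf (nbhd_pmf m))"
  by (rule finite_subset[OF set_pmf_nbhd_pmf]) simp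

lemma pmf_nbhd_pmf:
  assumes "W \<subseteq> {..<m}"
  shows "pmf (nbhd_pmf m) W = 1 / ((real m + 1) * real (m choose card W))"
proof -
  have W: "card W \<le> m"
    using assms card_mono[of "{..<m}" W] by simp
  have "pmf (nbhd_pmf m) W =
      (\<Sum>k\<in>{0..m}. pmf (pmf_of_set {W. W \<subseteq> {..<m} \<and> card W = k}) W) / (real m + 1)"
    unfolding nbhd_pmf_def by (subst pmf_bind_pmf_of_set) (auto simp: add_ac)
  also have "(\<Sum>k\<in>{0..m}. pmf (pmf_of_set {W. W \<subseteq> {..<m} \<and> card W = k}) W)
      = (\<Sum>k\<in>{0..m}. if k = card W then 1 / real (m choose card W) else 0)"
    using assms
    by (intro sum.cong refl, subst pmf_of_set[OF subsets_card_nonempty finite_subsets_card])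
       (auto simp: n_subsets)
  also have "\<dots> = 1 / real (m choose card W)"
    using W by simp
  finally show ?thesis by (simp add: mult.commute)
qed

lemma surprisal_nbhd_pmf:
  assumes "W \<subseteq> {..<m}"
  shows "surprisal (nbhd_pmf m) W = log 2 ((real m + 1) * real (m choose card W))"
  using card_mono[OF _ assms] by (simp add: surprisal_def pmf_nbhd_pmf[OF assms] log_divide)

lemma expectation_surprisal_nbhd_pmf:
  "measure_pmf.expectation (nbhd_pmf m) (surprisal (nbhd_pmf m)) =
     log 2 (real m + 1) + (\<Sum>k\<le>m. log 2 (real (m choose k))) / (real m + 1)"
proof -
  have "measure_pmf.expectation (nbhd_pmf m) (surprisal (nbhd_pmf m)) =
      (\<Sum>k\<in>{0..m}. measure_pmf.expectation (pmf_of_set {W. W \<subseteq> {..<m} \<and> card W = k})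
         (surprisal (nbhd_pmf m)) / (real m + 1))"
    by (subst (1) nbhd_pmf_def, subst pmf_expectation_bind_pmf_of_set)
       (auto simp: set_pmf_of_subsets_card finite_subsets_card divide_inverse mult.commute add_ac)
  also have "\<dots> = (\<Sum>k\<in>{0..m}. log 2 ((real m + 1) * real (m choose k)) / (real m + 1))"
  proof (intro sum.cong refl)
    fix k assume "k \<in> {0..m}"
    then have "measure_pmf.expectation (pmf_of_set {W. W \<subseteq> {..<m} \<and> card W = k}) (surprisal (nbhd_pmf m))
        = measure_pmf.expectation (pmf_of_set {W. W \<subseteq> {..<m} \<and> card W = k})
            (\<lambda>_. log 2 ((real m + 1) * real (m choose k)))"
      by (intro expectation_cong_support) (auto simp: set_pmf_of_subsets_card surprisal_nbhd_pmf)
    then show "measure_pmf.expectation (pmf_of_set {W. W \<subseteq> {..<m} \<and> card W = k})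
         (surprisal (nbhd_pmf m)) / (real m + 1) = log 2 ((real m + 1) * real (m choose k)) / (real m + 1)"
      by simp
  qed
  also have "\<dots> = (\<Sum>k\<le>m. log 2 (real m + 1) + log 2 (real (m choose k))) / (real m + 1)"
    by (simp add: sum_divide_distrib atLeast0AtMost log_mult)
  also have "\<dots> = log 2 (real m + 1) + (\<Sum>k\<le>m. log 2 (real (m choose k))) / (real m + 1)"
    by (simp add: sum.distrib field_simps)
  finally show ?thesis .
qed

text \<open>
  The crude estimates \<open>m + 1 \<le> 2 ^ m\<close> and \<open>m choose k \<le> 2 ^ m\<close> suffice, since the variance only has
  to be of lower order than \<open>n ^ 4\<close>.
\<close>

lemma surprisal_nbhd_pmf_bounds:
  assumes "W \<subseteq> {..<m}"
  shows "0 \<le> surprisal (nbhd_pmf m) W" "surprisal (nbhd_pmf m) W \<le> 2 * real m"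
proof -
  have W: "card W \<le> m"
    using assms card_mono[of "{..<m}" W] by simp
  have pos: "m choose card W \<ge> 1"
    using W by (simp add: Suc_le_eq)
  have "(m + 1) * (m choose card W) \<le> 2 ^ m * 2 ^ m"
    using Suc_leI[OF less_exp[of m]] binomial_le_pow2[of m "card W"] by (intro mult_mono) auto
  then have "real ((m + 1) * (m choose card W)) \<le> real (2 ^ m * 2 ^ m)"
    by (rule of_nat_mono)
  also have "\<dots> = 2 powr (2 * real m)"
    by (simp add: powr_realpow[symmetric] powr_add[symmetric])
  finally have "(real m + 1) * real (m choose card W) \<le> 2 powr (2 * real m)"
    by (simp add: algebra_simps)
  then show "surprisal (nbhd_pmf m) W \<le> 2 * real m"
    using W by (simp add: surprisal_nbhd_pmf[OF assms] log_le_iff)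
  have "1 \<le> (m + 1) * (m choose card W)"
    using pos by simp
  then have "1 \<le> real ((m + 1) * (m choose card W))"
    by (metis of_nat_1 of_nat_mono)
  then have "1 \<le> (real m + 1) * real (m choose card W)"
    by (simp add: algebra_simps)
  then show "0 \<le> surprisal (nbhd_pmf m) W"
    by (simp add: surprisal_nbhd_pmf[OF assms])
qed

text \<open>
  The initial graph \<open>K\<^sub>1\<close> also arises from the empty graph by an attachment step, whose only choice
  is the empty neighbourhood. So the recursion already holds at \<open>m = 0\<close>.
\<close>

lemma seq_attach_Suc:
  "seq_attach (Suc m) = map_pmf (\<lambda>(G, W). attach m W G) (pair_pmf (seq_attach m) (nbhd_pmf m))"
proof -
  have "seq_attach (Suc m) = seq_attach m \<bind> attach_step m"
  proof (cases m)
    case 0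
    have "{W. W \<subseteq> {} \<and> card W = 0} = {{} :: nat set}" by auto
    then show ?thesis
      by (simp add: 0 attach_step_def attach_def bind_return_pmf pmf_of_set_singleton)
  qed simp
  also have "\<dots> = seq_attach m \<bind> (\<lambda>G. map_pmf (\<lambda>W. attach m W G) (nbhd_pmf m))"
  proof (intro bind_pmf_cong refl)
    fix G assume "G \<in> set_pmf (seq_attach m)"
    then have "verts G = {..<m}"
      using set_pmf_seq_attach[of m] by (auto simp: labelled_graphs_def)
    then show "attach_step m G = map_pmf (\<lambda>W. attach m W G) (nbhd_pmf m)"
      by (simp add: attach_step_def nbhd_pmf_def map_bind_pmf map_pmf_def bind_assoc_pmf)
  qed
  also have "\<dots> = map_pmf (\<lambda>(G, W). attach m W G) (pair_pmf (seq_attach m) (nbhd_pmf m))"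
    by (simp add: pair_pmf_def map_pmf_def bind_assoc_pmf bind_return_pmf)
  finally show ?thesis .
qed

text \<open>
  The newest vertex is known from its label, so the old graph and the chosen neighbourhood can be
  read off the new graph: no information about the choices is lost.
\<close>

lemma inj_on_attach:
  "inj_on (\<lambda>(G, W). attach m W G) (labelled_graphs m \<times> Pow {..<m})"
proof -
  let ?dec = "\<lambda>H. (({..<m}, {e \<in> edges H. m \<notin> e}), {w. {m, w} \<in> edges H})"
  have "?dec (attach m W G) = (G, W)" if G: "G \<in> labelled_graphs m" and W: "W \<subseteq> {..<m}" for G W
  proof -
    have V: "verts G = {..<m}" and e: "\<And>e. e \<in> edges G \<Longrightarrow> m \<notin> e"
      using G by (auto simp: labelled_graphs_def simple_graph_def)
    have "{e \<in> edges (attach m W G). m \<notin> e} = edges G"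
      using e by (auto simp: attach_def)
    moreover have "{w. {m, w} \<in> edges (attach m W G)} = W"
      using e W by (auto simp: attach_def doubleton_eq_iff)
    ultimately show ?thesis
      using V by (simp add: prod_eq_iff)
  qed
  then have "?dec (case z of (G, W) \<Rightarrow> attach m W G) = z"
    if "z \<in> labelled_graphs m \<times> Pow {..<m}" for z
    using that by (cases z) simp
  then show ?thesis
    by (rule inj_on_inverseI)
qed

lemma finite_set_pmf_seq_attach: "finite (set_pmf (seq_attach n))"
  by (rule finite_subset[OF set_pmf_seq_attach finite_labelled_graphs])

lemma surprisal_seq_attach_Suc:
  assumes G: "G \<in> set_pmf (seq_attach m)" and W: "W \<in> set_pmf (nbhd_pmf m)"
  shows "surprisal (seq_attach (Suc m)) (attach m W G) = surprisal (seq_attach m) G + surprisal (nbhd_pmf m) W"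
proof -
  have "inj_on (\<lambda>(G, W). attach m W G) (set_pmf (pair_pmf (seq_attach m) (nbhd_pmf m)))"
    using set_pmf_seq_attach[of m] set_pmf_nbhd_pmf[of m]
    by (intro inj_on_subset[OF inj_on_attach]) auto
  from pmf_map_inj[OF this, of "(G, W)"] have
    "pmf (seq_attach (Suc m)) (attach m W G) = pmf (seq_attach m) G * pmf (nbhd_pmf m) W"
    using G W by (simp add: seq_attach_Suc pmf_pair del: seq_attach.simps)
  then show ?thesis
    using pmf_positive[OF G] pmf_positive[OF W] by (simp add: surprisal_def log_mult)
qed

text \<open>
  For \<open>\<phi> = (\<lambda>x. x)\<close> this gives the recursion for the mean of the surprisal, and for a shifted square
  the one for its variance.
\<close>

lemma expectation_seq_attach_Suc:
  fixes \<phi> :: "real \<Rightarrow> real"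
  shows "measure_pmf.expectation (seq_attach (Suc m)) (\<lambda>H. \<phi> (surprisal (seq_attach (Suc m)) H)) =
   measure_pmf.expectation (pair_pmf (seq_attach m) (nbhd_pmf m))
     (\<lambda>z. \<phi> (surprisal (seq_attach m) (fst z) + surprisal (nbhd_pmf m) (snd z)))"
proof -
  have "measure_pmf.expectation (seq_attach (Suc m)) f =
      measure_pmf.expectation (pair_pmf (seq_attach m) (nbhd_pmf m)) (\<lambda>z. f (attach m (snd z) (fst z)))"
    for f :: "nat graph \<Rightarrow> real"
    by (simp only: seq_attach_Suc integral_map_pmf case_prod_unfold)
  also have "measure_pmf.expectation (pair_pmf (seq_attach m) (nbhd_pmf m))
        (\<lambda>z. \<phi> (surprisal (seq_attach (Suc m)) (attach m (snd z) (fst z)))) =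
      measure_pmf.expectation (pair_pmf (seq_attach m) (nbhd_pmf m))
        (\<lambda>z. \<phi> (surprisal (seq_attach m) (fst z) + surprisal (nbhd_pmf m) (snd z)))"
    by (rule expectation_cong_support)
       (simp only: set_pair_pmf mem_Times_iff surprisal_seq_attach_Suc)
  finally show ?thesis .
qed

lemma expectation_surprisal_seq_attach:
  "measure_pmf.expectation (seq_attach n) (surprisal (seq_attach n)) =
     (\<Sum>m<n. measure_pmf.expectation (nbhd_pmf m) (surprisal (nbhd_pmf m)))"
proof (induction n)
  case 0
  show ?case by (simp add: surprisal_def)
next
  case (Suc m)
  show ?case
    unfolding expectation_seq_attach_Suc[where \<phi> = "\<lambda>x. x" and m = m]
      expectation_pair_add[OF finite_set_pmf_seq_attach finite_set_pmf_nbhd_pmf,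
        where f = "surprisal (seq_attach m)" and g = "surprisal (nbhd_pmf m)"] Suc.IH
    by simp
qed

lemma variance_surprisal_seq_attach:
  "measure_pmf.variance (seq_attach n) (surprisal (seq_attach n)) =
     (\<Sum>m<n. measure_pmf.variance (nbhd_pmf m) (surprisal (nbhd_pmf m)))"
proof (induction n)
  case 0
  show ?case by (simp add: surprisal_def)
next
  case (Suc m)
  let ?X = "\<lambda>z. surprisal (seq_attach m) (fst z) + surprisal (nbhd_pmf m) (snd z)"
  have mean: "measure_pmf.expectation (seq_attach (Suc m)) (surprisal (seq_attach (Suc m))) =
      measure_pmf.expectation (pair_pmf (seq_attach m) (nbhd_pmf m)) ?X"
    using expectation_seq_attach_Suc[where \<phi> = "\<lambda>x. x" and m = m] .
  have "measure_pmf.variance (seq_attach (Suc m)) (surprisal (seq_attach (Suc m))) =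
      measure_pmf.variance (pair_pmf (seq_attach m) (nbhd_pmf m)) ?X"
    unfolding mean using expectation_seq_attach_Suc[where \<phi> = "\<lambda>x. (x - measure_pmf.expectation (pair_pmf (seq_attach m) (nbhd_pmf m)) ?X)\<^sup>2" and m = m] .
  also have "\<dots> = measure_pmf.variance (seq_attach m) (surprisal (seq_attach m)) +
      measure_pmf.variance (nbhd_pmf m) (surprisal (nbhd_pmf m))"
    by (rule variance_pair_add[OF finite_set_pmf_seq_attach finite_set_pmf_nbhd_pmf,
          where f = "surprisal (seq_attach m)" and g = "surprisal (nbhd_pmf m)"])
  finally show ?case
    unfolding Suc.IH by simp
qed

lemma variance_surprisal_seq_attach_le:
  "measure_pmf.variance (seq_attach n) (surprisal (seq_attach n)) \<le> 4 * real n ^ 3"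
proof -
  have "measure_pmf.variance (nbhd_pmf m) (surprisal (nbhd_pmf m)) \<le> 4 * real n ^ 2" if "m < n" for m
  proof -
    have "measure_pmf.variance (nbhd_pmf m) (surprisal (nbhd_pmf m)) =
       measure_pmf.expectation (nbhd_pmf m) (\<lambda>W. (surprisal (nbhd_pmf m) W)\<^sup>2) -
       (measure_pmf.expectation (nbhd_pmf m) (surprisal (nbhd_pmf m)))\<^sup>2"
      by (intro measure_pmf.variance_eq integrable_measure_pmf_finite finite_set_pmf_nbhd_pmf)
    also have "\<dots> \<le> measure_pmf.expectation (nbhd_pmf m) (\<lambda>W. (surprisal (nbhd_pmf m) W)\<^sup>2)"
      by simp
    also have "\<dots> \<le> measure_pmf.expectation (nbhd_pmf m) (\<lambda>W. (2 * real n)\<^sup>2)"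
    proof (intro expectation_mono_support finite_set_pmf_nbhd_pmf power_mono)
      fix W assume "W \<in> set_pmf (nbhd_pmf m)"
      then have "W \<subseteq> {..<m}" using set_pmf_nbhd_pmf by blast
      from surprisal_nbhd_pmf_bounds[OF this] that
      show "surprisal (nbhd_pmf m) W \<le> 2 * real n" "0 \<le> surprisal (nbhd_pmf m) W" by auto
    qed
    also have "\<dots> = 4 * real n ^ 2"
      by (simp add: power_mult_distrib)
    finally show ?thesis .
  qed
  then have "measure_pmf.variance (seq_attach n) (surprisal (seq_attach n)) \<le> (\<Sum>m<n. 4 * real n ^ 2)"
    unfolding variance_surprisal_seq_attach by (intro sum_mono) auto
  then show ?thesis by (simp add: power2_eq_square power3_eq_cube mult_ac)
qed

section \<open>Asymptotics of the entropy of one step\<close>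

text \<open>
  Both induction steps are instances of \<open>ln t \<le> t - 1\<close>, at \<open>t = (n + 1) / n\<close> for the lower bound and
  at its inverse for the upper one.
\<close>

lemma ln_fact_bounds:
  "n \<ge> 1 \<Longrightarrow> real n * ln (real n) - real n + 1 \<le> ln (fact n) \<and>
     ln (fact n) \<le> real n * ln (real n) - real n + 1 + ln (real n)"
proof (induction n rule: dec_induct)
  case base
  show ?case by simp
next
  case (step n)
  define x where "x = real n"
  have x: "x \<ge> 1" using step.hyps by (simp add: x_def)
  have f: "ln (fact (Suc n)) = ln (x + 1) + ln (fact n :: real)"
    by (simp add: ln_mult x_def add_ac)
  have "ln ((x + 1) / x) \<le> (x + 1) / x - 1" "ln (x / (x + 1)) \<le> x / (x + 1) - 1"
    using x by (intro ln_le_minus_one; simp)+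
  then have a: "ln (x + 1) - ln x \<le> 1 / x" and b: "ln x - ln (x + 1) \<le> - 1 / (x + 1)"
    using x by (simp_all add: ln_div field_simps)
  have a': "x * (ln (x + 1) - ln x) \<le> 1"
    using mult_left_mono[OF a, of x] x by simp
  have b': "(x + 1) * (ln x - ln (x + 1)) \<le> - 1"
    using mult_left_mono[OF b, of "x + 1"] x by simp
  show ?case
    using step.IH a' b' unfolding f
    by (simp add: x_def[symmetric] algebra_simps)
qed

definition sum_ln_binomial :: "nat \<Rightarrow> real" where
  "sum_ln_binomial m = (\<Sum>k\<le>m. ln (real (m choose k)))"

lemma ln_fact_eq_sum: "ln (fact n) = (\<Sum>k<n. ln (real (Suc k)))"
proof (induction n)
  case (Suc n)
  have "ln (fact (Suc n) :: real) = ln (real (Suc n)) + ln (fact n)"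
    unfolding fact_Suc by (rule ln_mult_pos) simp_all
  then show ?case
    using Suc.IH by (simp only: sum.lessThan_Suc add.commute)
qed simp

text \<open>
  From \<open>(m + 1 - k) * (m + 1 choose k) = (m + 1) * (m choose k)\<close>; the denominators \<open>m + 1 - k\<close>
  multiply to \<open>(m + 1)!\<close>. By Stirling's formula the increment is \<open>m + O(log m)\<close>, so the sum grows
  like \<open>m\<^sup>2 / 2\<close>.
\<close>

lemma sum_ln_binomial_Suc:
  "sum_ln_binomial (Suc m) = sum_ln_binomial m + (real (Suc m) * ln (real (Suc m)) - ln (fact (Suc m)))"
proof -
  have "ln (real (Suc m choose k)) = ln (real (m choose k)) + (ln (real (Suc m)) - ln (real (Suc (m - k))))"
    if "k \<le> m" for k
  proof -
    have "(Suc m - k) * (Suc m choose k) = Suc m * (m choose k)"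
      using binomial_absorb_comp[of "Suc m" k] by simp
    then have "real (Suc (m - k)) * real (Suc m choose k) = real (Suc m) * real (m choose k)"
      using that by (metis Suc_diff_le of_nat_mult)
    then have "ln (real (Suc (m - k)) * real (Suc m choose k)) = ln (real (Suc m) * real (m choose k))"
      by simp
    then show ?thesis
      using that by (simp add: ln_mult del: of_nat_Suc binomial_Suc_Suc)
  qed
  then have "(\<Sum>k\<le>m. ln (real (Suc m choose k))) =
      (\<Sum>k\<le>m. ln (real (m choose k)) + (ln (real (Suc m)) - ln (real (Suc (m - k)))))"
    by (intro sum.cong) auto
  also have "\<dots> = sum_ln_binomial m + (real (Suc m) * ln (real (Suc m)) - (\<Sum>k\<le>m. ln (real (Suc (m - k)))))"
    by (simp add: sum.distrib sum_subtractf sum_ln_binomial_def)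
  also have "(\<Sum>k\<le>m. ln (real (Suc (m - k)))) = ln (fact (Suc m))"
    using sum.nat_diff_reindex[of "\<lambda>k. ln (real (Suc k))" "Suc m"]
    unfolding ln_fact_eq_sum by (simp add: lessThan_Suc_atMost del: of_nat_Suc)
  finally show ?thesis
    by (simp add: sum_ln_binomial_def del: of_nat_Suc binomial_Suc_Suc)
qed

lemma sum_ln_binomial_bounds:
  "real m * (real m - 1) / 2 - real m * ln (real m + 1) \<le> sum_ln_binomial m \<and>
   sum_ln_binomial m \<le> real m * (real m - 1) / 2"
proof (induction m)
  case 0
  show ?case by (simp add: sum_ln_binomial_def)
next
  case (Suc m)
  define x where "x = real m"
  have x: "x \<ge> 0" and x': "real (Suc m) = x + 1" by (simp_all add: x_def)
  define d where "d = (x + 1) * ln (x + 1) - ln (fact (Suc m))"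
  have S: "sum_ln_binomial (Suc m) = sum_ln_binomial m + d"
    unfolding sum_ln_binomial_Suc d_def x' ..
  have d: "x - ln (x + 1) \<le> d" "d \<le> x"
    using ln_fact_bounds[of "Suc m"] unfolding d_def x' by auto
  have "(x + 1) * ln (x + 1) \<le> (x + 1) * ln (x + 1 + 1)"
    using x by (intro mult_left_mono) auto
  moreover have "(x + 1) * (x + 1 - 1) / 2 = x * (x - 1) / 2 + x"
    by (simp add: field_simps)
  moreover have "(x + 1) * ln (x + 1) = x * ln (x + 1) + ln (x + 1)"
    by (simp add: algebra_simps)
  ultimately show ?case
    using Suc.IH d unfolding S x' x_def[symmetric] by linarith
qed

text \<open>
  The lower bound has no logarithm: the choice of the degree contributes \<open>ln (m + 1)\<close>, which makes up
  for the logarithmic deficit of the average of \<open>ln (m choose k)\<close>.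
\<close>

lemma expectation_surprisal_nbhd_pmf_bounds:
  defines "h \<equiv> \<lambda>m. measure_pmf.expectation (nbhd_pmf m) (surprisal (nbhd_pmf m)) * ln 2"
  shows "real m / 2 - 1 \<le> h m" "h m \<le> real m / 2 + ln (real m + 1)"
proof -
  define x where "x = real m"
  have x: "x \<ge> 0" by (simp add: x_def)
  have h: "h m = ln (x + 1) + sum_ln_binomial m / (x + 1)"
  proof -
    have "(\<Sum>k\<le>m. log 2 (real (m choose k))) * ln 2 = sum_ln_binomial m"
      by (simp add: sum_distrib_right sum_ln_binomial_def log_def)
    then have "(\<Sum>k\<le>m. log 2 (real (m choose k))) / (x + 1) * ln 2 = sum_ln_binomial m / (x + 1)"
      by simp
    moreover have "log 2 (x + 1) * ln 2 = ln (x + 1)"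
      by (simp add: log_def)
    ultimately show ?thesis
      by (simp only: h_def expectation_surprisal_nbhd_pmf distrib_right x_def)
  qed
  have "sum_ln_binomial m \<le> x / 2 * (x + 1)"
    using sum_ln_binomial_bounds[of m] x by (simp add: x_def[symmetric] field_simps)
  then show "h m \<le> real m / 2 + ln (real m + 1)"
    using x by (simp add: h x_def[symmetric] pos_divide_le_eq)
  have "(x / 2 - 1 - ln (x + 1)) * (x + 1) \<le> x * (x - 1) / 2 - x * ln (x + 1)"
    using x by (simp add: field_simps)
  also have "\<dots> \<le> sum_ln_binomial m"
    using sum_ln_binomial_bounds[of m] by (simp add: x_def)
  finally show "real m / 2 - 1 \<le> h m"
    using x by (simp add: h x_def[symmetric] pos_le_divide_eq[symmetric])
qed

definition labelled_entropy :: "nat \<Rightarrow> real" where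
  "labelled_entropy n = measure_pmf.expectation (seq_attach n) (surprisal (seq_attach n))"

lemma labelled_entropy_bound:
  assumes "n \<ge> 1"
  shows "\<bar>labelled_entropy n - real n ^ 2 / (4 * ln 2)\<bar> \<le> (2 * real n + real n * ln (real n)) / ln 2"
proof -
  have gauss: "(\<Sum>m<n. real m / 2) = real n * (real n - 1) / 4" for n
    by (induction n) (simp_all add: algebra_simps add_divide_distrib diff_divide_distrib)
  let ?h = "\<lambda>m. measure_pmf.expectation (nbhd_pmf m) (surprisal (nbhd_pmf m))"
  have eq: "labelled_entropy n * ln 2 = (\<Sum>m<n. ?h m * ln 2)"
    by (simp add: labelled_entropy_def expectation_surprisal_seq_attach sum_distrib_right)
  have "(\<Sum>m<n. ?h m * ln 2) \<le> (\<Sum>m<n. real m / 2 + ln (real n))"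
  proof (intro sum_mono)
    fix m assume "m \<in> {..<n}"
    then have "ln (real m + 1) \<le> ln (real n)" by simp
    then show "?h m * ln 2 \<le> real m / 2 + ln (real n)"
      using expectation_surprisal_nbhd_pmf_bounds(2)[of m] by linarith
  qed
  then have upper: "labelled_entropy n * ln 2 \<le> real n * (real n - 1) / 4 + real n * ln (real n)"
    by (simp add: eq sum.distrib gauss)
  have "(\<Sum>m<n. real m / 2 - 1) \<le> (\<Sum>m<n. ?h m * ln 2)"
    using expectation_surprisal_nbhd_pmf_bounds(1) by (intro sum_mono)
  then have lower: "real n * (real n - 1) / 4 - real n \<le> labelled_entropy n * ln 2"
    by (simp add: eq sum_subtractf gauss)
  have "0 \<le> real n * ln (real n)" using assms by simp
  then have "\<bar>labelled_entropy n * ln 2 - real n ^ 2 / 4\<bar> \<le> 2 * real n + real n * ln (real n)"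
    using upper lower by (simp add: abs_le_iff field_simps power2_eq_square)
  moreover have "\<bar>labelled_entropy n - real n ^ 2 / (4 * ln 2)\<bar> * ln 2 = \<bar>labelled_entropy n * ln 2 - real n ^ 2 / 4\<bar>"
  proof -
    have "(labelled_entropy n - real n ^ 2 / (4 * ln 2)) * ln 2 = labelled_entropy n * ln 2 - real n ^ 2 / 4"
      by (simp add: left_diff_distrib)
    then show ?thesis
      using abs_mult[of "labelled_entropy n - real n ^ 2 / (4 * ln 2)" "ln 2"] by simp
  qed
  ultimately show ?thesis
    by (simp add: pos_le_divide_eq)
qed

section \<open>Passing to isomorphism classes\<close>

text \<open>
  A graph on \<open>{..<n}\<close> isomorphic to \<open>G\<close> is the image of \<open>G\<close> under a permutation of \<open>{..<n}\<close>.
\<close>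

lemma card_isomorphic_le_fact:
  assumes G: "G \<in> labelled_graphs n"
  shows "card {H \<in> labelled_graphs n. G \<cong>\<^sub>G H} \<le> fact n"
proof -
  let ?P = "{p. p permutes {..<n}}"
  let ?relabel = "\<lambda>p. ({..<n}, image p ` edges G)"
  have "{H \<in> labelled_graphs n. G \<cong>\<^sub>G H} \<subseteq> ?relabel ` ?P"
  proof
    fix H assume "H \<in> {H \<in> labelled_graphs n. G \<cong>\<^sub>G H}"
    then have H: "H \<in> labelled_graphs n" and iso: "G \<cong>\<^sub>G H" by auto
    have V: "verts G = {..<n}" "verts H = {..<n}"
      using G H by (auto simp: labelled_graphs_def)
    have E: "\<exists>u<n. \<exists>v<n. e = {u, v}" if "e \<in> edges G \<or> e \<in> edges H" for e
    proof -
      have "e \<subseteq> {..<n}" "card e = 2"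
        using that G H unfolding labelled_graphs_def simple_graph_def by blast+
      then show ?thesis
        unfolding card_2_iff by blast
    qed
    from iso V obtain f where f: "bij_betw f {..<n} {..<n}"
      and fe: "\<And>u v. u < n \<Longrightarrow> v < n \<Longrightarrow> {u, v} \<in> edges G \<longleftrightarrow> {f u, f v} \<in> edges H"
      unfolding graph_iso_def by auto
    \<comment> \<open>\<open>f\<close> is arbitrary outside \<open>{..<n}\<close>, where a permutation of \<open>{..<n}\<close> is the identity.\<close>
    define p where "p x = (if x < n then f x else x)" for x
    have "bij_betw p {..<n} {..<n}"
      using f by (subst bij_betw_cong[of _ _ f]) (auto simp: p_def)
    then have p: "p permutes {..<n}"
      by (intro bij_imp_permutes) (auto simp: p_def)
    have "image p ` edges G = edges H"
    proof (intro equalityI subsetI)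
      fix e assume "e \<in> image p ` edges G"
      then obtain e' where e': "e' \<in> edges G" "e = p ` e'" by auto
      with E obtain u v where "u < n" "v < n" "e' = {u, v}" by blast
      with e' fe show "e \<in> edges H" by (simp add: p_def)
    next
      fix e assume e: "e \<in> edges H"
      with E obtain u v where uv: "u < n" "v < n" "e = {u, v}" by blast
      with f obtain a b where ab: "a < n" "b < n" "u = f a" "v = f b"
        unfolding bij_betw_def by (metis imageE lessThan_iff)
      with e fe uv have "{a, b} \<in> edges G" by simp
      moreover have "e = p ` {a, b}" using uv ab by (simp add: p_def)
      ultimately show "e \<in> image p ` edges G" by blast
    qed
    then have "H = ?relabel p"
      using V by (simp add: prod_eq_iff)
    with p show "H \<in> ?relabel ` ?P" by blast
  qed
  then have "card {H \<in> labelled_graphs n. G \<cong>\<^sub>G H} \<le> card (?relabel ` ?P)"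
    by (intro card_mono finite_imageI) (auto simp: finite_permutations)
  also have "\<dots> \<le> card ?P"
    by (intro card_image_le) (auto simp: finite_permutations)
  also have "\<dots> = fact n"
    by (rule card_permutations) auto
  finally show ?thesis .
qed

lemma log_fact_le: "n \<ge> 1 \<Longrightarrow> log 2 (fact n) \<le> real n * ln (real n) / ln 2"
proof -
  assume n: "n \<ge> 1"
  have "(fact n :: real) \<le> real n ^ n"
    using fact_le_power[of n, where 'a = real] by simp
  then have "ln (fact n :: real) \<le> ln (real n ^ n)"
    using n by (subst ln_le_cancel_iff) auto
  then show ?thesis
    using n by (simp add: log_def ln_realpow divide_right_mono)
qed

lemma class_eq_iff_iso:
  assumes "G \<in> labelled_graphs n" "H \<in> labelled_graphs n"
  shows "iso_rel n `` {H} = iso_rel n `` {G} \<longleftrightarrow> G \<cong>\<^sub>G H"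
proof -
  have "iso_rel n `` {H} = iso_rel n `` {G} \<longleftrightarrow> (G, H) \<in> iso_rel n"
    using eq_equiv_class_iff[OF equiv_iso_rel assms] by (simp only: eq_commute)
  also have "\<dots> \<longleftrightarrow> G \<cong>\<^sub>G H"
    using assms by (simp add: iso_rel_def)
  finally show ?thesis .
qed

lemma surprisal_class_loss_le:
  assumes "n \<ge> 1"
  shows "measure_pmf.expectation (seq_attach n)
      (\<lambda>G. surprisal (seq_attach n) G - surprisal (likelihood_pmf n) (iso_rel n `` {G}))
    \<le> real n * ln (real n) / ln 2"
proof -
  have "measure_pmf.expectation (seq_attach n)
      (\<lambda>G. surprisal (seq_attach n) G - surprisal (likelihood_pmf n) (iso_rel n `` {G})) \<le> log 2 (real (fact n))"
    unfolding likelihood_pmf_def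
  proof (intro expectation_surprisal_loss_le finite_set_pmf_seq_attach)
    fix G assume "G \<in> set_pmf (seq_attach n)"
    then have G: "G \<in> labelled_graphs n" using set_pmf_seq_attach by blast
    have "{H \<in> set_pmf (seq_attach n). iso_rel n `` {H} = iso_rel n `` {G}}
        \<subseteq> {H \<in> labelled_graphs n. G \<cong>\<^sub>G H}"
      using set_pmf_seq_attach[of n] class_eq_iff_iso[OF G] by blast
    then have "card {H \<in> set_pmf (seq_attach n). iso_rel n `` {H} = iso_rel n `` {G}}
        \<le> card {H \<in> labelled_graphs n. G \<cong>\<^sub>G H}"
      using finite_labelled_graphs by (intro card_mono) auto
    also have "\<dots> \<le> fact n" by (rule card_isomorphic_le_fact[OF G])
    finally show "card {H \<in> set_pmf (seq_attach n). iso_rel n `` {H} = iso_rel n `` {G}} \<le> fact n" .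
  qed simp
  with log_fact_le[OF assms] show ?thesis by simp
qed

lemma finite_set_pmf_likelihood_pmf: "finite (set_pmf (likelihood_pmf n))"
  by (rule finite_subset[OF set_pmf_likelihood_pmf finite_iso_classes])

lemma entropy_likelihood_bounds:
  assumes "n \<ge> 1"
  shows "entropy_bits (likelihood_pmf n) \<le> labelled_entropy n"
    and "labelled_entropy n - real n * ln (real n) / ln 2 \<le> entropy_bits (likelihood_pmf n)"
proof -
  let ?T = "\<lambda>G. surprisal (likelihood_pmf n) (iso_rel n `` {G})"
  have eq: "entropy_bits (likelihood_pmf n) = measure_pmf.expectation (seq_attach n) ?T"
  proof -
    have "measure_pmf.expectation (likelihood_pmf n) f =
        measure_pmf.expectation (seq_attach n) (\<lambda>G. f (iso_rel n `` {G}))" for f :: "nat graph set \<Rightarrow> real"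
      by (simp only: likelihood_pmf_def integral_map_pmf)
    then show ?thesis
      unfolding entropy_bits_eq_expectation[OF finite_set_pmf_likelihood_pmf] .
  qed
  have le: "?T G \<le> surprisal (seq_attach n) G" if "G \<in> set_pmf (seq_attach n)" for G
    unfolding likelihood_pmf_def using surprisal_map_le[OF that] .
  show "entropy_bits (likelihood_pmf n) \<le> labelled_entropy n"
    unfolding eq labelled_entropy_def
    by (intro expectation_mono_support finite_set_pmf_seq_attach le)
  have "measure_pmf.expectation (seq_attach n) (\<lambda>G. surprisal (seq_attach n) G - ?T G)
      = labelled_entropy n - entropy_bits (likelihood_pmf n)"
    unfolding eq labelled_entropy_def
    by (intro Bochner_Integration.integral_diff integrable_measure_pmf_finite finite_set_pmf_seq_attach)
  with surprisal_class_loss_le[OF assms]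
  show "labelled_entropy n - real n * ln (real n) / ln 2 \<le> entropy_bits (likelihood_pmf n)"
    by simp
qed

lemma card_labelled_graphs: "card (labelled_graphs n) = 2 ^ (n choose 2)"
proof -
  have "labelled_graphs n = Pair {..<n} ` Pow {e. e \<subseteq> {..<n} \<and> card e = 2}"
    unfolding labelled_graphs_def simple_graph_def
    by (intro set_eqI) (simp add: image_iff prod_eq_iff Pow_def, metis finite_lessThan)
  moreover have "card (Pow {e. e \<subseteq> {..<n} \<and> card e = 2}) = 2 ^ (n choose 2)"
    by (subst card_Pow) (auto simp: n_subsets finite_subsets_card)
  moreover have "inj_on (Pair {..<n}) A" for A :: "nat set set set"
    by (simp add: inj_on_def)
  ultimately show ?thesis
    by (simp only: card_image)
qed

lemma card_iso_classes_bounds: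
  "card (iso_classes n) \<le> 2 ^ (n choose 2)"
  "2 ^ (n choose 2) \<le> fact n * card (iso_classes n)"
proof -
  have "iso_classes n = (\<lambda>G. iso_rel n `` {G}) ` labelled_graphs n"
    by (auto simp: iso_classes_def quotient_def)
  then show "card (iso_classes n) \<le> 2 ^ (n choose 2)"
    using card_image_le[OF finite_labelled_graphs[of n], of "\<lambda>G. iso_rel n `` {G}"]
    by (simp add: card_labelled_graphs)
  have "card (labelled_graphs n) = card (\<Union> (iso_classes n))"
    unfolding iso_classes_def by (simp add: Union_quotient[OF equiv_iso_rel])
  also have "\<dots> \<le> (\<Sum>C\<in>iso_classes n. card C)"
    by (rule card_Union_le_sum_card)
  also have "\<dots> \<le> (\<Sum>C\<in>iso_classes n. fact n)"
  proof (intro sum_mono)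
    fix C assume "C \<in> iso_classes n"
    then obtain G where G: "G \<in> labelled_graphs n" "C = iso_rel n `` {G}"
      by (auto simp: iso_classes_def quotient_def)
    then have "C = {H \<in> labelled_graphs n. G \<cong>\<^sub>G H}"
      by (auto simp: iso_rel_def)
    then show "card C \<le> fact n"
      using card_isomorphic_le_fact[OF G(1)] by (simp only:)
  qed
  finally show "2 ^ (n choose 2) \<le> fact n * card (iso_classes n)"
    by (simp add: card_labelled_graphs mult.commute)
qed

lemma entropy_uniform:
  assumes "finite A" "A \<noteq> {}"
  shows "entropy_bits (pmf_of_set A) = log 2 (card A)"
proof -
  have "entropy_bits (pmf_of_set A) = measure_pmf.expectation (pmf_of_set A) (surprisal (pmf_of_set A))"
    using assms by (intro entropy_bits_eq_expectation) simp
  also have "\<dots> = measure_pmf.expectation (pmf_of_set A) (\<lambda>_. log 2 (card A))"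
    using assms by (intro expectation_cong_support) (simp add: surprisal_def log_divide card_gt_0_iff)
  finally show ?thesis by simp
qed

lemma entropy_uniform_iso_classes_bound:
  assumes "n \<ge> 1"
  shows "\<bar>entropy_bits (pmf_of_set (iso_classes n)) - real n ^ 2 / 2\<bar> \<le> real n + real n * ln (real n) / ln 2"
proof -
  let ?c = "card (iso_classes n)"
  have c: "?c > 0"
    using finite_iso_classes iso_classes_nonempty by (simp add: card_gt_0_iff)
  have ch: "real (n choose 2) = real n * (real n - 1) / 2"
    using assms by (simp add: choose_two real_of_nat_div)
  have "real ?c \<le> 2 ^ (n choose 2)"
    using of_nat_mono[OF card_iso_classes_bounds(1)[of n], where 'a = real] by simp
  then have "log 2 ?c \<le> log 2 (2 ^ (n choose 2))"
    using c by (subst log_le_cancel_iff) auto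
  then have 1: "log 2 ?c \<le> real n * (real n - 1) / 2"
    by (simp add: log_nat_power ch)
  have "(2::real) ^ (n choose 2) \<le> fact n * real ?c"
    using of_nat_mono[OF card_iso_classes_bounds(2)[of n], where 'a = real] by simp
  then have "log 2 (2 ^ (n choose 2)) \<le> log 2 (fact n * real ?c)"
    using c by (subst log_le_cancel_iff) auto
  then have "real n * (real n - 1) / 2 \<le> log 2 (fact n) + log 2 ?c"
    using c by (simp add: log_nat_power ch log_mult)
  with log_fact_le[OF assms] have 2: "real n * (real n - 1) / 2 - real n * ln (real n) / ln 2 \<le> log 2 ?c"
    by linarith
  have "0 \<le> real n * ln (real n) / ln 2" using assms by simp
  with 1 2 show ?thesis
    unfolding entropy_uniform[OF finite_iso_classes iso_classes_nonempty]
    by (simp add: abs_le_iff power2_eq_square right_diff_distrib diff_divide_distrib)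
qed

section \<open>Concentration of the likelihood\<close>

text \<open>
  For a deviation \<open>y\<close> and \<open>a > 0\<close>, \<open>\<bar>y\<bar> \<le> y\<^sup>2 / a + a\<close>. The choice \<open>a = n powr (3/2)\<close> is the order of the
  bound on the standard deviation and balances the two terms.
\<close>

lemma expectation_abs_deviation_le:
  assumes "n \<ge> 1"
  shows "measure_pmf.expectation (seq_attach n) (\<lambda>G. \<bar>surprisal (seq_attach n) G - labelled_entropy n\<bar>)
    \<le> 5 * real n * sqrt (real n)"
proof -
  define a where "a = real n * sqrt (real n)"
  have a: "a > 0" using assms by (simp add: a_def)
  have int: "integrable (seq_attach n) h" for h :: "nat graph \<Rightarrow> real"
    by (intro integrable_measure_pmf_finite finite_set_pmf_seq_attach)
  have "\<bar>y\<bar> \<le> y\<^sup>2 / a + a" for y :: real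
  proof (cases "\<bar>y\<bar> \<le> a")
    case False
    then have "\<bar>y\<bar> * a \<le> \<bar>y\<bar> * \<bar>y\<bar>" by (intro mult_left_mono) auto
    then have "\<bar>y\<bar> \<le> y\<^sup>2 / a" using a by (simp add: pos_le_divide_eq power2_eq_square)
    then show ?thesis using a by simp
  qed (use a in \<open>simp add: add_increasing\<close>)
  then have "measure_pmf.expectation (seq_attach n) (\<lambda>G. \<bar>surprisal (seq_attach n) G - labelled_entropy n\<bar>)
     \<le> measure_pmf.expectation (seq_attach n) (\<lambda>G. (surprisal (seq_attach n) G - labelled_entropy n)\<^sup>2 / a + a)"
    by (intro expectation_mono_support finite_set_pmf_seq_attach)
  also have "\<dots> = measure_pmf.variance (seq_attach n) (surprisal (seq_attach n)) / a + a"
    by (subst Bochner_Integration.integral_add) (auto intro!: int simp: labelled_entropy_def)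
  also have "\<dots> \<le> 4 * real n ^ 3 / a + a"
    using a variance_surprisal_seq_attach_le[of n] by (simp add: divide_right_mono)
  also have "4 * real n ^ 3 / a = 4 * a"
    using a by (simp add: divide_eq_eq a_def power3_eq_cube mult_ac)
  finally show ?thesis by (simp add: a_def mult_ac)
qed

lemma tendsto_const_in_prob_L1:
  assumes fin: "\<And>n. finite (set_pmf (p n))"
    and lim: "(\<lambda>n. measure_pmf.expectation (p n) (\<lambda>x. \<bar>X n x - c\<bar>)) \<longlonglongrightarrow> 0"
  shows "tendsto_const_in_prob p X c"
  unfolding tendsto_const_in_prob_def
proof (intro allI impI)
  fix e :: real assume e: "e > 0"
  let ?E = "\<lambda>n. measure_pmf.expectation (p n) (\<lambda>x. \<bar>X n x - c\<bar>)"
  have bound: "measure_pmf.prob (p n) {x. \<bar>X n x - c\<bar> > e} \<le> ?E n / e" for n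
  proof -
    have "measure_pmf.prob (p n) {x. \<bar>X n x - c\<bar> > e} \<le> measure_pmf.prob (p n) {x. \<bar>X n x - c\<bar> \<ge> e}"
      by (intro measure_pmf.finite_measure_mono) auto
    also have "\<dots> \<le> ?E n / e"
      using integral_Markov_inequality_measure[of "measure_pmf (p n)" "\<lambda>x. \<bar>X n x - c\<bar>" UNIV e] e
        integrable_measure_pmf_finite[OF fin, of n "\<lambda>x. \<bar>X n x - c\<bar>"]
      by simp
    finally show ?thesis .
  qed
  show "(\<lambda>n. measure_pmf.prob (p n) {x. \<bar>X n x - c\<bar> > e}) \<longlonglongrightarrow> 0"
  proof (rule tendsto_sandwich[OF _ _ tendsto_const])
    show "\<forall>\<^sub>F n in sequentially. 0 \<le> measure_pmf.prob (p n) {x. \<bar>X n x - c\<bar> > e}"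
      by (intro always_eventually allI measure_nonneg)
    show "\<forall>\<^sub>F n in sequentially. measure_pmf.prob (p n) {x. \<bar>X n x - c\<bar> > e} \<le> ?E n / e"
      by (intro always_eventually allI bound)
    show "(\<lambda>n. ?E n / e) \<longlonglongrightarrow> 0"
      using tendsto_divide[OF lim tendsto_const[of e]] e by simp
  qed
qed

lemma surprisal_class_eq_likelihood:
  assumes "G \<in> set_pmf (seq_attach n)"
  shows "surprisal (likelihood_pmf n) (iso_rel n `` {G}) = - log 2 (likelihood G)"
proof -
  have "G \<in> labelled_graphs n"
    using assms set_pmf_seq_attach by blast
  then show ?thesis
    by (simp only: surprisal_def pmf_likelihood_pmf)
qed

text \<open>
  Triangle inequality, from the surprisal of the class to that of the labelled graph, to its mean,
  to \<open>n\<^sup>2 / (4 ln 2)\<close>. The first difference has a sign, so that its absolute value has the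
  expectation bounded by the loss lemma.
\<close>

lemma expectation_abs_rate_le:
  assumes n: "n \<ge> 1"
  shows "measure_pmf.expectation (seq_attach n)
      (\<lambda>G. \<bar>- (1 / real n ^ 2) * log 2 (likelihood G) - 1 / (4 * ln 2)\<bar>)
    \<le> (real n * ln (real n) / ln 2 + 5 * real n * sqrt (real n) +
        (2 * real n + real n * ln (real n)) / ln 2) / real n ^ 2"
proof -
  let ?E = "measure_pmf.expectation (seq_attach n)"
  let ?S = "surprisal (seq_attach n)"
  let ?T = "\<lambda>G. surprisal (likelihood_pmf n) (iso_rel n `` {G})"
  let ?\<mu> = "labelled_entropy n" and ?c = "real n ^ 2 / (4 * ln 2)"
  have int: "integrable (seq_attach n) h" for h :: "nat graph \<Rightarrow> real"
    by (intro integrable_measure_pmf_finite finite_set_pmf_seq_attach)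
  have n2: "real n ^ 2 > 0" using n by simp
  have pointwise: "\<bar>- (1 / real n ^ 2) * log 2 (likelihood G) - 1 / (4 * ln 2)\<bar>
      \<le> ((?S G - ?T G) + \<bar>?S G - ?\<mu>\<bar> + \<bar>?\<mu> - ?c\<bar>) / real n ^ 2" if G: "G \<in> set_pmf (seq_attach n)" for G
  proof -
    have "- (1 / real n ^ 2) * log 2 (likelihood G) - 1 / (4 * ln 2) = (?T G - ?c) / real n ^ 2"
      using n by (simp add: surprisal_class_eq_likelihood[OF G] diff_divide_distrib)
    moreover have "?T G \<le> ?S G"
      unfolding likelihood_pmf_def using surprisal_map_le[OF G] .
    then have "\<bar>?T G - ?c\<bar> \<le> (?S G - ?T G) + \<bar>?S G - ?\<mu>\<bar> + \<bar>?\<mu> - ?c\<bar>"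
      by linarith
    ultimately show ?thesis
      using n2 by (simp add: abs_divide divide_right_mono del: zero_less_power)
  qed
  have "?E (\<lambda>G. \<bar>- (1 / real n ^ 2) * log 2 (likelihood G) - 1 / (4 * ln 2)\<bar>)
     \<le> ?E (\<lambda>G. ((?S G - ?T G) + \<bar>?S G - ?\<mu>\<bar> + \<bar>?\<mu> - ?c\<bar>) / real n ^ 2)"
    by (intro expectation_mono_support finite_set_pmf_seq_attach pointwise)
  also have "\<dots> = (?E (\<lambda>G. ?S G - ?T G) + ?E (\<lambda>G. \<bar>?S G - ?\<mu>\<bar>) + \<bar>?\<mu> - ?c\<bar>) / real n ^ 2"
    by (simp add: int)
  also have "\<dots> \<le> (real n * ln (real n) / ln 2 + 5 * real n * sqrt (real n) +
        (2 * real n + real n * ln (real n)) / ln 2) / real n ^ 2"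
    by (intro divide_right_mono add_mono surprisal_class_loss_le expectation_abs_deviation_le
        labelled_entropy_bound n) simp
  finally show ?thesis .
qed

lemma bigo_of_bound:
  fixes f g :: "nat \<Rightarrow> real"
  assumes "\<And>n. n \<ge> 1 \<Longrightarrow> \<bar>f n\<bar> \<le> g n"
  shows "f \<in> O(g)"
proof (rule landau_o.big_mono, rule eventually_mono[OF eventually_ge_at_top[of 1]])
  fix n :: nat assume "1 \<le> n"
  from assms[OF this] show "norm (f n) \<le> norm (g n)"
    by simp
qed

theorem theorem7:
  shows "(\<lambda>n::nat. entropy_bits (likelihood_pmf n) - real n ^ 2 / (4 * ln 2))
           \<in> O(\<lambda>n. real n * ln (real n))
       \<and> (\<lambda>n::nat. entropy_bits (pmf_of_set (iso_classes n)) - real n ^ 2 / 2)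
           \<in> O(\<lambda>n. real n * ln (real n))
       \<and> tendsto_const_in_prob seq_attach
           (\<lambda>n G. - (1 / real n ^ 2) * log 2 (likelihood G)) (1 / (4 * ln 2))"
proof (intro conjI)
  let ?L = "\<lambda>n::nat. real n * ln (real n)"
  let ?e = "\<lambda>n::nat. (2 * real n + ?L n) / ln 2 + ?L n / ln 2"
  have "\<bar>entropy_bits (likelihood_pmf n) - real n ^ 2 / (4 * ln 2)\<bar> \<le> ?e n" if n: "n \<ge> 1" for n
  proof -
    have "\<bar>x - c\<bar> \<le> b + d" if "\<bar>y - c\<bar> \<le> b" "x \<le> y" "y - d \<le> x" "0 \<le> d" for x y b c d :: real
      using that by linarith
    from this[OF labelled_entropy_bound[OF n] entropy_likelihood_bounds[OF n]]
    show ?thesis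
      using n by simp
  qed
  then have "(\<lambda>n. entropy_bits (likelihood_pmf n) - real n ^ 2 / (4 * ln 2)) \<in> O(?e)"
    by (rule bigo_of_bound)
  also have "?e \<in> O(?L)" by real_asymp
  finally show "(\<lambda>n::nat. entropy_bits (likelihood_pmf n) - real n ^ 2 / (4 * ln 2)) \<in> O(?L)" .
next
  let ?L = "\<lambda>n::nat. real n * ln (real n)"
  have "(\<lambda>n. entropy_bits (pmf_of_set (iso_classes n)) - real n ^ 2 / 2) \<in> O(\<lambda>n. real n + ?L n / ln 2)"
    using entropy_uniform_iso_classes_bound by (rule bigo_of_bound)
  also have "(\<lambda>n. real n + ?L n / ln 2) \<in> O(?L)" by real_asymp
  finally show "(\<lambda>n::nat. entropy_bits (pmf_of_set (iso_classes n)) - real n ^ 2 / 2) \<in> O(?L)" .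
next
  let ?X = "\<lambda>n G. - (1 / real n ^ 2) * log 2 (likelihood G)"
  let ?b = "\<lambda>n. (real n * ln (real n) / ln 2 + 5 * real n * sqrt (real n) +
        (2 * real n + real n * ln (real n)) / ln 2) / real n ^ 2"
  have "(\<lambda>n. measure_pmf.expectation (seq_attach n) (\<lambda>G. \<bar>?X n G - 1 / (4 * ln 2)\<bar>)) \<longlonglongrightarrow> 0"
  proof (rule tendsto_sandwich[OF _ _ tendsto_const])
    show "\<forall>\<^sub>F n in sequentially. 0 \<le> measure_pmf.expectation (seq_attach n) (\<lambda>G. \<bar>?X n G - 1 / (4 * ln 2)\<bar>)"
      by (intro always_eventually allI Bochner_Integration.integral_nonneg) simp
    show "\<forall>\<^sub>F n in sequentially. measure_pmf.expectation (seq_attach n) (\<lambda>G. \<bar>?X n G - 1 / (4 * ln 2)\<bar>) \<le> ?b n"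
      by (rule eventually_mono[OF eventually_ge_at_top[of 1] expectation_abs_rate_le])
    show "?b \<longlonglongrightarrow> 0" by real_asymp
  qed
  then show "tendsto_const_in_prob seq_attach ?X (1 / (4 * ln 2))"
    by (rule tendsto_const_in_prob_L1[OF finite_set_pmf_seq_attach])
qed

end
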